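(* For any integer $k \geq 1$, any graph of contiguity $k$ has symmetric difference at most $2k$.
   Context: All graphs are finite and simple. The contiguity of a graph $G$ is the minimum $k$ for which there is a linear order of $V(G)$ such that, for every vertex $x$, the (open) neighbourhood $N(x)$ can be split into at most $k$ intervals (sets of consecutive vertices in the linear order). For two distinct vertices $x,y$ of a graph $G$, $\mathrm{sd}(x,y)$ is the number of vertices in $V(G)\setminus\{x,y\}$ adjacent to exactly one of $x$ and $y$. The symmetric difference $\mathrm{sd}(G)$ of $G$ is the smallest number such that every induced subgraph $H$ of $G$ (with at least two vertices) contains a pair of distinct vertices whose symmetric difference, computed in $H$, is at most $\mathrm{sd}(G)$. *)

theory Defs
  imports "Graph_Theory.Digraph_Component" "HOL-Library.Disjoint_Sets"
begin

text \<open>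
  A finite simple graph is a \<^locale>\<open>graph\<close> of the library: a finite, symmetric, loop-free digraph
  without parallel arcs. Adjacency of \<open>x\<close> and \<open>y\<close> is \<open>x \<rightarrow>\<^bsub>G\<^esub> y\<close>.
\<close>

definition open_nbhd :: "('a, 'b) pre_digraph \<Rightarrow> 'a \<Rightarrow> 'a set" where
  "open_nbhd G x = {y \<in> verts G. x \<rightarrow>\<^bsub>G\<^esub> y}"

definition order_interval :: "'a set \<Rightarrow> 'a rel \<Rightarrow> 'a set \<Rightarrow> bool" where
  "order_interval V r I \<longleftrightarrow>
     I \<subseteq> V \<and> (\<forall>x\<in>I. \<forall>y\<in>I. \<forall>z\<in>V. (x, z) \<in> r \<longrightarrow> (z, y) \<in> r \<longrightarrow> z \<in> I)"

text \<open>
  The parts of a \<^const>\<open>partition_on\<close> are nonempty; an empty neighbourhood is split into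
  no intervals at all.
\<close>

definition contiguity_at_most :: "('a, 'b) pre_digraph \<Rightarrow> nat \<Rightarrow> bool" where
  "contiguity_at_most G k \<longleftrightarrow>
     (\<exists>r. linear_order_on (verts G) r \<and>
       (\<forall>x\<in>verts G. \<exists>P. partition_on (open_nbhd G x) P \<and> finite P \<and> card P \<le> k \<and>
         (\<forall>I\<in>P. order_interval (verts G) r I)))"

definition contiguity :: "('a, 'b) pre_digraph \<Rightarrow> nat" where
  "contiguity G = (LEAST k. contiguity_at_most G k)"

definition sd_pair :: "('a, 'b) pre_digraph \<Rightarrow> 'a \<Rightarrow> 'a \<Rightarrow> nat" where
  "sd_pair G x y = card {z \<in> verts G - {x, y}. (x \<rightarrow>\<^bsub>G\<^esub> z) \<noteq> (y \<rightarrow>\<^bsub>G\<^esub> z)}"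

definition sd_at_most :: "('a, 'b) pre_digraph \<Rightarrow> nat \<Rightarrow> bool" where
  "sd_at_most G s \<longleftrightarrow>
     (\<forall>H. induced_subgraph H G \<longrightarrow> 2 \<le> card (verts H) \<longrightarrow>
       (\<exists>x\<in>verts H. \<exists>y\<in>verts H. x \<noteq> y \<and> sd_pair H x y \<le> s))"

definition sd :: "('a, 'b) pre_digraph \<Rightarrow> nat" where
  "sd G = (LEAST s. sd_at_most G s)"

text \<open>For finite graphs both minima are attained.\<close>

lemma contiguity_at_most_contiguity:
  assumes "graph G"
  shows "contiguity_at_most G (contiguity G)"
proof -
  interpret graph G by fact
  obtain r where r: "linear_order_on (verts G) r"
    using well_order_on unfolding well_order_on_def by blast
  have "\<exists>P. partition_on (open_nbhd G x) P \<and> finite P \<and> card P \<le> card (verts G) \<and>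
      (\<forall>I\<in>P. order_interval (verts G) r I)" for x
  proof (intro exI conjI)
    let ?P = "(\<lambda>y. {y}) ` open_nbhd G x"
    have sub: "open_nbhd G x \<subseteq> verts G" by (auto simp: open_nbhd_def)
    then have fin: "finite (open_nbhd G x)" by (rule finite_subset) simp
    show "partition_on (open_nbhd G x) ?P"
      by (auto simp: partition_on_def disjoint_def)
    show "finite ?P" using fin by simp
    show "card ?P \<le> card (verts G)"
      using card_image_le[OF fin] card_mono[OF finite_verts sub] by (rule le_trans)
    show "\<forall>I\<in>?P. order_interval (verts G) r I"
      using r sub by (auto simp: order_interval_def linear_order_on_def partial_order_on_def
          dest: antisymD)
  qed
  then have "contiguity_at_most G (card (verts G))"
    using r unfolding contiguity_at_most_def by blast
  then show ?thesis unfolding contiguity_def by (rule LeastI)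
qed

lemma sd_at_most_sd:
  assumes "graph G"
  shows "sd_at_most G (sd G)"
proof -
  interpret graph G by fact
  have "sd_at_most G (card (verts G))"
    unfolding sd_at_most_def
  proof (intro allI impI)
    fix H assume H: "induced_subgraph H G" and two: "2 \<le> card (verts H)"
    have HG: "verts H \<subseteq> verts G" using H by (auto simp: induced_subgraph_def subgraph_def)
    have fin: "finite (verts H)" using HG finite_verts by (rule finite_subset)
    obtain x y where xy: "x \<in> verts H" "y \<in> verts H" "x \<noteq> y"
      using two by (metis card_le_Suc0_iff_eq fin not_less_eq_eq numeral_2_eq_2)
    have "sd_pair H x y \<le> card (verts G)"
      unfolding sd_pair_def by (rule card_mono[OF finite_verts]) (use HG in auto)
    then show "\<exists>x\<in>verts H. \<exists>y\<in>verts H. x \<noteq> y \<and> sd_pair H x y \<le> card (verts G)"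
      using xy by blast
  qed
  then show ?thesis unfolding sd_def by (rule LeastI)
qed

end

theory Submission
  imports Defs
begin

text \<open>
  Restrict the linear order to the vertex set \<open>A\<close> of an induced subgraph. A union of at most \<open>k\<close>
  intervals separates at most \<open>2 k\<close> of the \<open>card A - 1\<close> pairs of consecutive vertices, so summing
  over the neighbourhoods, the symmetric differences of the consecutive pairs have total at most
  \<open>2 k \<cdot> card A\<close>. If \<open>card A > 2 k + 1\<close>, this is less than \<open>(2 k + 1) (card A - 1)\<close>, so some
  consecutive pair has symmetric difference at most \<open>2 k\<close>. Otherwise any pair works, as there are
  at most \<open>2 k\<close> other vertices.
\<close>

lemma finite_linear_order_on_least:
  assumes "linear_order_on V r" "finite B" "B \<noteq> {}" "B \<subseteq> V"
  shows "\<exists>m\<in>B. \<forall>y\<in>B. (m, y) \<in> r"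
  using assms(2-4)
proof (induction rule: finite_ne_induct)
  case (singleton x)
  with assms(1) show ?case
    by (auto simp: order_on_defs refl_on_def)
next
  case (insert x F)
  then obtain m where m: "m \<in> F" "\<forall>y\<in>F. (m, y) \<in> r" by auto
  have refl: "(x, x) \<in> r" and trans: "trans r" and total: "(m, x) \<in> r \<or> (x, m) \<in> r"
    using assms(1) insert.prems insert.hyps m
    by (auto simp: order_on_defs refl_on_def total_on_def)
  from total show ?case
  proof
    assume "(m, x) \<in> r"
    with m show ?thesis by blast
  next
    assume "(x, m) \<in> r"
    with m refl trans show ?thesis by (blast dest: transD)
  qed
qed

text \<open>Here \<open>m\<close> is the greatest element of \<open>A\<close> and \<open>s\<close>
  the immediate successor map of the order restricted to \<open>A\<close>, so the pairs
  \<open>x\<close>, \<open>s x\<close> with \<open>x\<close> in \<open>A - {m}\<close> are exactly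
  the consecutive ones.\<close>

lemma finite_linear_order_on_successor:
  assumes r: "linear_order_on V r" and "finite A" "A \<noteq> {}" "A \<subseteq> V"
  obtains m s where "m \<in> A"
    and "\<And>x. x \<in> A - {m} \<Longrightarrow> s x \<in> A \<and> s x \<noteq> x \<and> (x, s x) \<in> r"
    and "\<And>x y. x \<in> A - {m} \<Longrightarrow> y \<in> A \<Longrightarrow> (x, y) \<in> r \<Longrightarrow> y \<noteq> x \<Longrightarrow> (s x, y) \<in> r"
proof -
  have "linear_order_on V (r\<inverse>)" using r by simp
  from finite_linear_order_on_least[OF this assms(2-4)]
  obtain m where m: "m \<in> A" "\<forall>y\<in>A. (y, m) \<in> r" by auto
  \<comment> \<open>The witness is the least element of \<open>A\<close> strictly above
    \<open>x\<close>; there is one because \<open>m\<close> lies strictly above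
    \<open>x\<close>.\<close>
  have "\<exists>t. t \<in> A \<and> t \<noteq> x \<and> (x, t) \<in> r \<and> (\<forall>y\<in>A. (x, y) \<in> r \<longrightarrow> y \<noteq> x \<longrightarrow> (t, y) \<in> r)"
    if "x \<in> A - {m}" for x
    using finite_linear_order_on_least[OF r, of "{y\<in>A. (x, y) \<in> r \<and> y \<noteq> x}"] m that assms
    by fastforce
  then obtain s where "\<forall>x\<in>A - {m}. s x \<in> A \<and> s x \<noteq> x \<and> (x, s x) \<in> r \<and>
      (\<forall>y\<in>A. (x, y) \<in> r \<longrightarrow> y \<noteq> x \<longrightarrow> (s x, y) \<in> r)"
    by metis
  with m(1) show thesis by (intro that[of m s]) blast+
qed

text \<open>Walking through \<open>A\<close> in order, one can leave each interval of
  \<open>P\<close> for a point outside \<open>N\<close> at most once, and enter it from outside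
  \<open>N\<close> at most once. \<open>?U\<close> collects the exits and \<open>?L\<close> the
  entries.\<close>

lemma card_separated_consecutive_le:
  assumes r: "linear_order_on V r" and A: "A \<subseteq> V" "m \<in> A"
    and s: "\<And>x. x \<in> A - {m} \<Longrightarrow> s x \<in> A \<and> s x \<noteq> x \<and> (x, s x) \<in> r"
    and least: "\<And>x y. x \<in> A - {m} \<Longrightarrow> y \<in> A \<Longrightarrow> (x, y) \<in> r \<Longrightarrow> y \<noteq> x \<Longrightarrow> (s x, y) \<in> r"
    and P: "partition_on N P" "finite P" "card P \<le> k" "\<forall>I\<in>P. order_interval V r I"
  shows "card {x \<in> A - {m}. (x \<in> N) \<noteq> (s x \<in> N)} \<le> 2 * k"
proof -
  let ?U = "{x \<in> A - {m}. x \<in> N \<and> s x \<notin> N}" and ?L = "{x \<in> A - {m}. x \<notin> N \<and> s x \<in> N}"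
  have N: "\<Union>P = N" using P(1) by (auto simp: partition_on_def)
  have antisym: "antisym r" and total: "total_on V r"
    using r by (auto simp: order_on_defs)
  \<comment> \<open>Charge each \<open>x\<close> in \<open>S\<close> to a part containing
    \<open>f x\<close>. The charging is injective, and by totality of \<open>r\<close> only ordered
    pairs need to be compared. Exits use the identity for \<open>f\<close>, entries use
    \<open>s\<close>.\<close>
  have le: "card S \<le> k" if f: "\<forall>x\<in>S. f x \<in> N"
    and inj: "\<And>I x y. I \<in> P \<Longrightarrow> x \<in> S \<Longrightarrow> y \<in> S \<Longrightarrow> f x \<in> I \<Longrightarrow> f y \<in> I \<Longrightarrow> (x, y) \<in> r \<Longrightarrow> x = y"
    and "S \<subseteq> A" for S f
  proof -
    have "\<forall>x\<in>S. \<exists>I. I \<in> P \<and> f x \<in> I" using f N by auto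
    then obtain g where g: "\<forall>x\<in>S. g x \<in> P \<and> f x \<in> g x" by metis
    have "inj_on g S"
    proof (rule inj_onI)
      fix x y assume xy: "x \<in> S" "y \<in> S" "g x = g y"
      then have "x = y \<or> (x, y) \<in> r \<or> (y, x) \<in> r"
        using total A \<open>S \<subseteq> A\<close> unfolding total_on_def by blast
      then show "x = y" using inj[of "g x" x y] inj[of "g x" y x] g xy by auto
    qed
    then have "card S \<le> card P" using g P(2) by (intro card_inj_on_le) auto
    with P(3) show ?thesis by simp
  qed
  have "x = y" if "I \<in> P" "x \<in> ?U" "y \<in> ?U" "x \<in> I" "y \<in> I" "(x, y) \<in> r" for I x y
  proof (rule ccontr)
    assume "x \<noteq> y"
    \<comment> \<open>\<open>s x\<close> lies between \<open>x\<close> and \<open>y\<close>, so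
      convexity of \<open>I\<close> puts it into \<open>N\<close>, although \<open>x\<close> is an
      exit.\<close>
    then have "(s x, y) \<in> r" "(x, s x) \<in> r" "s x \<in> V" using that s[of x] least[of x y] A by auto
    then have "s x \<in> I" using that P(4) unfolding order_interval_def by blast
    then show False using that N by auto
  qed
  then have U: "card ?U \<le> k" by (intro le[of _ "\<lambda>x. x"]) auto
  have "x = y" if "I \<in> P" "x \<in> ?L" "y \<in> ?L" "s x \<in> I" "s y \<in> I" "(x, y) \<in> r" for I x y
  proof (rule ccontr)
    assume "x \<noteq> y"
    \<comment> \<open>Now \<open>y\<close> lies between \<open>s x\<close> and \<open>s y\<close>,
      so convexity of \<open>I\<close> puts it into \<open>N\<close>, although \<open>y\<close> is
      an entry.\<close>
    then have "(s x, y) \<in> r" "(y, s y) \<in> r" "y \<in> V" using that s[of y] least[of x y] A by auto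
    then have "y \<in> I" using that P(4) unfolding order_interval_def by blast
    then show False using that N by auto
  qed
  then have L: "card ?L \<le> k" by (intro le[of _ s]) auto
  have split: "{x \<in> A - {m}. (x \<in> N) \<noteq> (s x \<in> N)} = ?U \<union> ?L" by auto
  show ?thesis unfolding split using U L card_Un_le[of ?U ?L] by linarith
qed

lemma exists_pair_rarely_separated:
  assumes r: "linear_order_on V r" and A: "A \<subseteq> V" "finite A" and large: "2 * k + 1 < card A"
    and P: "\<And>z. z \<in> A \<Longrightarrow> \<exists>P. partition_on (N z) P \<and> finite P \<and> card P \<le> k \<and>
      (\<forall>I\<in>P. order_interval V r I)"
  shows "\<exists>x\<in>A. \<exists>y\<in>A. x \<noteq> y \<and> card {z \<in> A. (x \<in> N z) \<noteq> (y \<in> N z)} \<le> 2 * k"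
proof (rule ccontr)
  assume contra: "\<not> ?thesis"
  have "A \<noteq> {}" using large by auto
  from finite_linear_order_on_successor[OF r A(2) this A(1)]
  obtain m s where m: "m \<in> A"
    and s: "\<And>x. x \<in> A - {m} \<Longrightarrow> s x \<in> A \<and> s x \<noteq> x \<and> (x, s x) \<in> r"
    and least: "\<And>x y. x \<in> A - {m} \<Longrightarrow> y \<in> A \<Longrightarrow> (x, y) \<in> r \<Longrightarrow> y \<noteq> x \<Longrightarrow> (s x, y) \<in> r"
    by blast
  have "(card A - 1) * (2 * k + 1) = (\<Sum>x\<in>A - {m}. 2 * k + 1)" using m A by simp
  also have "\<dots> \<le> (\<Sum>x\<in>A - {m}. card {z \<in> A. (x \<in> N z) \<noteq> (s x \<in> N z)})"
    using contra s by (intro sum_mono) (metis DiffE Suc_eq_plus1 not_less_eq_eq)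
  \<comment> \<open>Double counting of the pairs \<open>(x, z)\<close> for which \<open>N z\<close>
    separates \<open>x\<close> from \<open>s x\<close>.\<close>
  also have "\<dots> = (\<Sum>z\<in>A. card {x \<in> A - {m}. (x \<in> N z) \<noteq> (s x \<in> N z)})"
    unfolding card_eq_sum using A(2) by (intro sum.swap_restrict) auto
  also have "\<dots> \<le> (\<Sum>z\<in>A. 2 * k)"
  proof (rule sum_mono)
    fix z assume "z \<in> A"
    with P obtain Q where Q: "partition_on (N z) Q" "finite Q" "card Q \<le> k"
      "\<forall>I\<in>Q. order_interval V r I" by metis
    show "card {x \<in> A - {m}. (x \<in> N z) \<noteq> (s x \<in> N z)} \<le> 2 * k"
      by (rule card_separated_consecutive_le[OF r A(1) m s least Q])
  qed
  finally have "(card A - 1) * (2 * k + 1) \<le> card A * (2 * k)" by simp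
  \<comment> \<open>With \<open>card A = n + 1\<close> the inequality reads
    \<open>n * (2 * k + 1) \<le> (n + 1) * (2 * k)\<close>, that is \<open>n \<le> 2 * k\<close>,
    against \<open>large\<close>.\<close>
  moreover obtain n where "card A = Suc n" using large by (cases "card A") auto
  ultimately show False using large by simp
qed

lemma induced_subgraph_dominates_iff:
  assumes "induced_subgraph H G" "x \<in> verts H" "y \<in> verts H"
  shows "x \<rightarrow>\<^bsub>H\<^esub> y \<longleftrightarrow> x \<rightarrow>\<^bsub>G\<^esub> y"
proof -
  have "compatible G H" "arcs H = {e \<in> arcs G. tail G e \<in> verts H \<and> head G e \<in> verts H}"
    using assms(1) by (auto simp: induced_subgraph_def subgraph_def)
  with assms(2,3) show ?thesis
    by (auto simp: arcs_ends_def arc_to_ends_def compatible_def)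
qed

text \<open>The order and the intervals stay those of \<open>G\<close>; the subgraph
  \<open>H\<close> enters the counting only through its vertex set.\<close>

lemma sd_at_most_contiguity_at_most:
  assumes "graph G" and contig: "contiguity_at_most G k"
  shows "sd_at_most G (2 * k)"
  unfolding sd_at_most_def
proof (intro allI impI)
  interpret graph G by fact
  fix H assume H: "induced_subgraph H G" and two: "2 \<le> card (verts H)"
  have HG: "verts H \<subseteq> verts G" using H by (auto simp: induced_subgraph_def subgraph_def)
  have fin: "finite (verts H)" using HG finite_verts by (rule finite_subset)
  show "\<exists>x\<in>verts H. \<exists>y\<in>verts H. x \<noteq> y \<and> sd_pair H x y \<le> 2 * k"
  proof (cases "2 * k + 1 < card (verts H)")
    case True
    from contig obtain r where r: "linear_order_on (verts G) r"
      and P: "\<forall>x\<in>verts G. \<exists>P. partition_on (open_nbhd G x) P \<and> finite P \<and> card P \<le> k \<and>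
         (\<forall>I\<in>P. order_interval (verts G) r I)"
      unfolding contiguity_at_most_def by blast
    have "\<exists>P. partition_on (open_nbhd G z) P \<and> finite P \<and> card P \<le> k \<and>
         (\<forall>I\<in>P. order_interval (verts G) r I)" if "z \<in> verts H" for z
      using P HG that by blast
    from exists_pair_rarely_separated[where N = "open_nbhd G", OF r HG fin True this]
    obtain x y where xy: "x \<in> verts H" "y \<in> verts H" "x \<noteq> y" and
      le: "card {z \<in> verts H. (x \<in> open_nbhd G z) \<noteq> (y \<in> open_nbhd G z)} \<le> 2 * k"
      by blast
    \<comment> \<open>The counting tests whether \<open>v\<close> lies in the neighbourhood of
      \<open>z\<close>, while \<open>sd_pair\<close> tests arcs from \<open>v\<close> to
      \<open>z\<close>; symmetry of \<open>G\<close> reconciles the two.\<close>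
    have "v \<in> open_nbhd G z \<longleftrightarrow> v \<rightarrow>\<^bsub>H\<^esub> z" if "v \<in> verts H" "z \<in> verts H" for v z
      using that HG induced_subgraph_dominates_iff[OF H that]
        arcs_ends_symmetric[OF sym_arcs, of v z] arcs_ends_symmetric[OF sym_arcs, of z v]
      unfolding open_nbhd_def by blast
    then have "sd_pair H x y \<le> card {z \<in> verts H. (x \<in> open_nbhd G z) \<noteq> (y \<in> open_nbhd G z)}"
      unfolding sd_pair_def using xy fin by (intro card_mono) auto
    with le xy show ?thesis by (meson le_trans)
  next
    case False
    obtain x y where xy: "x \<in> verts H" "y \<in> verts H" "x \<noteq> y"
      using two by (metis card_le_Suc0_iff_eq fin not_less_eq_eq numeral_2_eq_2)
    have "sd_pair H x y \<le> card (verts H - {x, y})"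
      unfolding sd_pair_def using fin by (intro card_mono) auto
    also have "\<dots> \<le> 2 * k" using False xy fin by (simp add: card_Diff_subset)
    finally show ?thesis using xy by blast
  qed
qed

theorem theorem6:
  fixes G :: "('a, 'b) pre_digraph" and k :: nat
  assumes "graph G"
    and "k \<ge> 1"
    and "contiguity G = k"
  shows "sd G \<le> 2 * k"
proof -
  have "contiguity_at_most G k"
    using contiguity_at_most_contiguity[OF assms(1)] assms(3) by simp
  then have "sd_at_most G (2 * k)"
    by (rule sd_at_most_contiguity_at_most[OF assms(1)])
  then show ?thesis unfolding sd_def by (rule Least_le)
qed

end
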